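(* If $G$ is a finite simple graph with independence number $\alpha(G) \le 2$, then $\chi(G) \le \Delta_2(G) + 2$. Equivalently, if $H$ is a finite triangle-free graph, then $\overline{\chi}(H) \le \overline{\Delta_2}(H) + 2$.
   Context: For distinct vertices $u,v$, $\operatorname{codeg}(u,v)$ is the number of common neighbors, and $\Delta_2(G)=\max_{u\ne v}\operatorname{codeg}(u,v)$. The anti-codegree of vertices $v,w$ of $H$ is $\overline{\operatorname{codeg}}(v,w) = |V(H)\setminus(N(v)\cup N(w)\cup\{v,w\})|$, and $\overline{\Delta_2}(H)=\max_{v,w}\overline{\operatorname{codeg}}(v,w)$ (which equals $\Delta_2$ of the complement of $H$). $\overline{\chi}(H)$ is the clique cover number of $H$, i.e. the minimum number of cliques needed to cover $V(H)$. *)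

theory Defs
  imports Complex_Main "HOL-Library.Ramsey"
begin

text \<open>A graph is a vertex set \<open>V\<close> together with a set \<open>E\<close> of two-element subsets of \<open>V\<close>.
  Cliques and independent sets are the predicates \<^const>\<open>clique\<close> and \<^const>\<open>indep\<close> of
  \<^theory>\<open>HOL-Library.Ramsey\<close>.\<close>

definition finite_simple_graph :: "'a set \<Rightarrow> 'a set set \<Rightarrow> bool" where
  "finite_simple_graph V E \<longleftrightarrow> finite V \<and> E \<subseteq> [V]\<^bsup>2\<^esup>"

definition neighbors :: "'a set \<Rightarrow> 'a set set \<Rightarrow> 'a \<Rightarrow> 'a set" where
  "neighbors V E v = {u \<in> V. {u, v} \<in> E}"

definition codeg :: "'a set \<Rightarrow> 'a set set \<Rightarrow> 'a \<Rightarrow> 'a \<Rightarrow> nat" where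
  "codeg V E u v = card (neighbors V E u \<inter> neighbors V E v)"

text \<open>Inserting \<open>0\<close> only matters when there are fewer than two vertices, in which case the
  maximum over pairs of distinct vertices is taken to be \<open>0\<close>.\<close>

definition max_codeg :: "'a set \<Rightarrow> 'a set set \<Rightarrow> nat" where
  "max_codeg V E = Max (insert 0 {codeg V E u v | u v. u \<in> V \<and> v \<in> V \<and> u \<noteq> v})"

definition anti_codeg :: "'a set \<Rightarrow> 'a set set \<Rightarrow> 'a \<Rightarrow> 'a \<Rightarrow> nat" where
  "anti_codeg V E v w = card (V - (neighbors V E v \<union> neighbors V E w \<union> {v, w}))"

definition max_anti_codeg :: "'a set \<Rightarrow> 'a set set \<Rightarrow> nat" where
  "max_anti_codeg V E = Max (insert 0 {anti_codeg V E v w | v w. v \<in> V \<and> w \<in> V \<and> v \<noteq> w})"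

definition independence_number :: "'a set \<Rightarrow> 'a set set \<Rightarrow> nat" where
  "independence_number V E = Max {card S | S. S \<subseteq> V \<and> indep S E}"

definition proper_coloring :: "'a set \<Rightarrow> 'a set set \<Rightarrow> ('a \<Rightarrow> nat) \<Rightarrow> bool" where
  "proper_coloring V E c \<longleftrightarrow> (\<forall>u\<in>V. \<forall>v\<in>V. {u, v} \<in> E \<longrightarrow> c u \<noteq> c v)"

definition chromatic_number :: "'a set \<Rightarrow> 'a set set \<Rightarrow> nat" where
  "chromatic_number V E = (LEAST k. \<exists>c. c ` V \<subseteq> {..<k} \<and> proper_coloring V E c)"

definition clique_cover :: "'a set \<Rightarrow> 'a set set \<Rightarrow> 'a set set \<Rightarrow> bool" where
  "clique_cover V E C \<longleftrightarrow> (\<forall>K\<in>C. K \<subseteq> V \<and> clique K E) \<and> \<Union>C = V"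

definition clique_cover_number :: "'a set \<Rightarrow> 'a set set \<Rightarrow> nat" where
  "clique_cover_number V E = (LEAST k. \<exists>C. finite C \<and> card C = k \<and> clique_cover V E C)"

definition triangle_free :: "'a set \<Rightarrow> 'a set set \<Rightarrow> bool" where
  "triangle_free V E \<longleftrightarrow> \<not> (\<exists>T. T \<subseteq> V \<and> card T = 3 \<and> clique T E)"

text \<open>Sanity check: the maximum anti-codegree is the maximum codegree of the complement. This is
  why both maxima range over pairs of distinct vertices.\<close>

lemma max_anti_codeg_eq_max_codeg_complement:
  "max_anti_codeg V E = max_codeg V ([V]\<^bsup>2\<^esup> - E)"
proof -
  have mem: "{u, v} \<in> [V]\<^bsup>2\<^esup> \<longleftrightarrow> u \<in> V \<and> v \<in> V \<and> u \<noteq> v" for u v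
    by (auto simp: nsets_def card_insert_if)
  have "anti_codeg V E v w = codeg V ([V]\<^bsup>2\<^esup> - E) v w" if "v \<in> V" "w \<in> V" for v w
  proof -
    have "V - (neighbors V E v \<union> neighbors V E w \<union> {v, w})
        = neighbors V ([V]\<^bsup>2\<^esup> - E) v \<inter> neighbors V ([V]\<^bsup>2\<^esup> - E) w"
      using that by (auto simp: neighbors_def mem)
    then show ?thesis
      by (simp add: anti_codeg_def codeg_def)
  qed
  then have "{anti_codeg V E v w | v w. v \<in> V \<and> w \<in> V \<and> v \<noteq> w}
      = {codeg V ([V]\<^bsup>2\<^esup> - E) v w | v w. v \<in> V \<and> w \<in> V \<and> v \<noteq> w}"
    by (intro Collect_cong) metis
  then show ?thesis
    by (simp add: max_anti_codeg_def max_codeg_def)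
qed

end

theory Submission
  imports Defs "HOL-Library.Disjoint_Sets"
begin

text \<open>
  The complement of a graph with independence number at most 2 is triangle-free, so it suffices to
  bound the clique cover number of a triangle-free graph on \<open>n\<close> vertices. A maximum matching \<open>M\<close>
  gives a cover by \<open>n - |M|\<close> cliques, hence two distinct vertices whose closed neighborhoods together
  have at most \<open>|M| + 2\<close> elements are enough.

  If two vertices are unmatched, they will do: an edge of \<open>M\<close> meets the union of their neighborhoods
  in at most one point, as otherwise there is a triangle or an augmenting path.

  Otherwise \<open>|M| = \<lfloor>n/2\<rfloor>\<close>. Suppose that no pair works. Then the neighborhoods of any two non-adjacent
  vertices cover more than half of the graph, that is, their codegree is at most
  \<open>d(v) + d(w) - (n + 1)/2\<close>. Summing this over the non-neighbors \<open>w\<close> of \<open>v\<close>, and then over \<open>v\<close>, yields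
  an average degree of at least \<open>(n + 1)/3\<close>. Conversely, adjacent \<open>w, w'\<close> have no common neighbor in
  \<open>N(v)\<close>; summing over the edges \<open>ww'\<close> among the non-neighbors of \<open>v\<close> yields an average degree of at
  most \<open>(n + 1)/3\<close>. Hence equality holds throughout: the graph is \<open>d\<close>-regular with \<open>n = 3d - 1\<close>, and
  all non-adjacent pairs have codegree \<open>d/2\<close>. This forces \<open>d = 2\<close> and \<open>n = 5\<close>, but in a 5-cycle
  any two adjacent vertices work.
\<close>

subsection \<open>Finite sums and cardinalities\<close>

lemma obtain_two_elements:
  assumes "2 \<le> card A"
  obtains x y where "x \<in> A" "y \<in> A" "x \<noteq> y"
proof -
  obtain B where "B \<subseteq> A" "card B = 2"
    using obtain_subset_with_card_n[OF assms] by blast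
  then show ?thesis
    using that by (auto simp: card_2_iff)
qed

lemma card_le_if_each_meets_at_most_once:
  assumes "finite M" "A \<subseteq> \<Union>M" "\<And>e. e \<in> M \<Longrightarrow> card (e \<inter> A) \<le> 1"
  shows "card A \<le> card M"
proof -
  have "A = (\<Union>e\<in>M. e \<inter> A)"
    using assms(2) by blast
  then have "card A \<le> (\<Sum>e\<in>M. card (e \<inter> A))"
    using card_UN_le[OF assms(1), of "\<lambda>e. e \<inter> A"] by simp
  also have "\<dots> \<le> card M"
    using sum_bounded_above[of M "\<lambda>e. card (e \<inter> A)" 1] assms(3) by simp
  finally show ?thesis .
qed

lemma sum_squared_deviations:
  fixes f :: "'a \<Rightarrow> 'b::comm_ring_1"
  shows "(\<Sum>x\<in>A. (of_nat (card A) * f x - sum f A)\<^sup>2)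
    = of_nat (card A) * (of_nat (card A) * (\<Sum>x\<in>A. (f x)\<^sup>2) - (sum f A)\<^sup>2)"
proof -
  define n s where "n = (of_nat (card A) :: 'b)" and "s = sum f A"
  have "(\<Sum>x\<in>A. (n * f x - s)\<^sup>2) = (\<Sum>x\<in>A. n\<^sup>2 * (f x)\<^sup>2 - 2 * n * s * f x + s\<^sup>2)"
    by (intro sum.cong) (simp_all add: power2_eq_square algebra_simps)
  also have "\<dots> = n\<^sup>2 * (\<Sum>x\<in>A. (f x)\<^sup>2) - 2 * n * s * s + n * s\<^sup>2"
    by (simp add: sum.distrib sum_subtractf sum_distrib_left n_def s_def)
  also have "\<dots> = n * (n * (\<Sum>x\<in>A. (f x)\<^sup>2) - s\<^sup>2)"
    by (simp add: power2_eq_square algebra_simps)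
  finally show ?thesis
    unfolding n_def s_def .
qed

lemma sum_squared_le_card_mult_sum_squares:
  fixes f :: "'a \<Rightarrow> 'b::linordered_idom"
  shows "(sum f A)\<^sup>2 \<le> of_nat (card A) * (\<Sum>x\<in>A. (f x)\<^sup>2)"
proof (cases "card A = 0")
  case True
  then have "sum f A = 0"
    by (auto simp: card_eq_0_iff)
  then show ?thesis
    by (simp add: sum_nonneg)
next
  case False
  have "0 \<le> of_nat (card A) * (of_nat (card A) * (\<Sum>x\<in>A. (f x)\<^sup>2) - (sum f A)\<^sup>2)"
    unfolding sum_squared_deviations[symmetric] by (intro sum_nonneg) simp
  then show ?thesis
    using False by (simp add: zero_le_mult_iff)
qed

lemma sum_squared_eq_card_mult_sum_squares_imp_const:
  fixes f :: "'a \<Rightarrow> 'b::linordered_idom"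
  assumes "finite A" "(sum f A)\<^sup>2 = of_nat (card A) * (\<Sum>x\<in>A. (f x)\<^sup>2)" "x \<in> A"
  shows "of_nat (card A) * f x = sum f A"
proof -
  have "(\<Sum>x\<in>A. (of_nat (card A) * f x - sum f A)\<^sup>2) = 0"
    using assms(2) by (simp add: sum_squared_deviations)
  then show ?thesis
    using assms(1,3) by (simp add: sum_nonneg_eq_0_iff)
qed

text \<open>In the next two lemmas, \<open>P\<close> and \<open>Q\<close> stand for the sums of the degrees and of their squares.
  The first two assumptions confine \<open>P\<close> to the interval from \<open>n(n + 1)/3\<close> to \<open>n(n - 1)/2\<close>.\<close>

lemma first_moment_lower_bound:
  fixes n P Q :: "'a::linordered_idom"
  assumes cauchy_schwarz: "P\<^sup>2 \<le> n * Q"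
    and averaging: "6 * Q + n ^ 3 + P \<le> 5 * n * P + n"
    and "5 \<le> n"
  shows "n * (n + 1) \<le> 3 * P"
proof (rule ccontr)
  assume "\<not> ?thesis"
  then have less: "3 * P < n * (n + 1)"
    by simp
  have "5 * n \<le> n * n"
    using \<open>5 \<le> n\<close> by (intro mult_right_mono) auto
  then have "2 * (n * (n + 1)) \<le> 3 * (n * (n - 1))"
    by (simp add: algebra_simps)
  with less have "2 * P < n * (n - 1)"
    by linarith
  with less have "0 < (n * (n + 1) - 3 * P) * (n * (n - 1) - 2 * P)"
    by (intro mult_pos_pos) auto
  also have "\<dots> = 6 * P\<^sup>2 + n * (n ^ 3 + P) - n * (5 * n * P + n)"
    by (simp add: algebra_simps power2_eq_square power3_eq_cube)
  also have "\<dots> \<le> 6 * P\<^sup>2 + n * (n ^ 3 + P) - n * (6 * Q + n ^ 3 + P)"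
    using mult_left_mono[OF averaging, of n] \<open>5 \<le> n\<close> by simp
  also have "\<dots> = 6 * (P\<^sup>2 - n * Q)"
    by (simp add: algebra_simps)
  also have "\<dots> \<le> 0"
    using cauchy_schwarz by simp
  finally show False
    by simp
qed

lemma moment_inequalities_tight:
  fixes n P Q :: "'a::linordered_idom"
  assumes cauchy_schwarz: "P\<^sup>2 \<le> n * Q"
    and averaging: "6 * Q + n ^ 3 + P \<le> 5 * n * P + n"
    and edge_counting: "(n + 3) * Q \<le> P\<^sup>2 + (n + 1) * P"
    and "5 \<le> n"
  shows "P\<^sup>2 = n * Q" "3 * P = n * (n + 1)"
proof -
  note P_ge = first_moment_lower_bound[OF cauchy_schwarz averaging \<open>5 \<le> n\<close>]
  have "0 < n * (n + 1)"
    using \<open>5 \<le> n\<close> by simp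
  then have "0 < P"
    using P_ge by linarith
  have scaled: "(n + 3) * (n * Q) \<le> n * P\<^sup>2 + P * (n * (n + 1))"
    using mult_left_mono[OF edge_counting, of n] \<open>5 \<le> n\<close> by (simp add: algebra_simps)
  also have "\<dots> \<le> n * P\<^sup>2 + P * (3 * P)"
    using P_ge \<open>0 < P\<close> by (intro add_left_mono mult_left_mono) auto
  also have "\<dots> = (n + 3) * P\<^sup>2"
    by (simp add: algebra_simps power2_eq_square)
  finally show squares: "P\<^sup>2 = n * Q"
    using cauchy_schwarz \<open>5 \<le> n\<close> by simp
  have "P * (3 * P) \<le> P * (n * (n + 1))"
    using scaled unfolding squares[symmetric] by (simp add: algebra_simps power2_eq_square)
  then show "3 * P = n * (n + 1)"
    using \<open>0 < P\<close> P_ge by simp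
qed

subsection \<open>Degrees and codegrees\<close>

locale simple_graph =
  fixes V :: "'a set" and E :: "'a set set"
  assumes finite_simple_graph: "finite_simple_graph V E"
begin

abbreviation N :: "'a \<Rightarrow> 'a set" where
  "N \<equiv> neighbors V E"

definition closed_neighbors :: "'a \<Rightarrow> 'a set" where
  "closed_neighbors v = insert v (N v)"

definition nonneighbors :: "'a \<Rightarrow> 'a set" where
  "nonneighbors v = V - closed_neighbors v"

definition degree :: "'a \<Rightarrow> nat" where
  "degree v = card (N v)"

definition neighbor_degree_sum :: "'a \<Rightarrow> nat" where
  "neighbor_degree_sum v = (\<Sum>y\<in>N v. degree y)"

definition degree_sum :: nat where
  "degree_sum = (\<Sum>v\<in>V. degree v)"

definition degree_square_sum :: nat where
  "degree_square_sum = (\<Sum>v\<in>V. (degree v)\<^sup>2)"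

lemma finite_vertices [simp]: "finite V"
  using finite_simple_graph by (simp add: finite_simple_graph_def)

lemma edges_subset_nsets: "E \<subseteq> [V]\<^bsup>2\<^esup>"
  using finite_simple_graph by (simp add: finite_simple_graph_def)

lemma finite_edges: "finite E"
  using edges_subset_nsets finite_imp_finite_nsets[OF finite_vertices] by (rule finite_subset)

lemma edge_imp_vertices:
  assumes "{x, y} \<in> E"
  shows "x \<in> V" "y \<in> V" "x \<noteq> y"
  using subsetD[OF edges_subset_nsets assms] by simp_all

lemma mem_neighbors: "u \<in> N v \<longleftrightarrow> {u, v} \<in> E"
  using edge_imp_vertices(1)[of u v] by (auto simp: neighbors_def)

lemma neighbors_commute: "u \<in> N v \<longleftrightarrow> v \<in> N u"
  by (simp add: mem_neighbors insert_commute)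

lemma not_mem_own_neighbors [simp]: "v \<notin> N v"
  using edge_imp_vertices(3)[of v v] by (auto simp: mem_neighbors)

lemma neighbors_subset: "N v \<subseteq> V"
  by (auto simp: neighbors_def)

lemma finite_neighbors [simp]: "finite (N v)"
  using neighbors_subset finite_vertices by (rule finite_subset)

lemma mem_nonneighbors: "w \<in> nonneighbors v \<longleftrightarrow> w \<in> V \<and> w \<noteq> v \<and> w \<notin> N v"
  by (auto simp: nonneighbors_def closed_neighbors_def)

lemma finite_nonneighbors [simp]: "finite (nonneighbors v)"
  by (simp add: nonneighbors_def)

lemma sum_closed_neighbors_add_nonneighbors:
  fixes f :: "'a \<Rightarrow> 'b::comm_monoid_add"
  assumes "v \<in> V"
  shows "f v + sum f (N v) + sum f (nonneighbors v) = sum f V"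
proof -
  have "closed_neighbors v \<subseteq> V"
    using assms neighbors_subset by (auto simp: closed_neighbors_def)
  then have "sum f (nonneighbors v) + sum f (closed_neighbors v) = sum f V"
    unfolding nonneighbors_def by (intro sum.subset_diff[symmetric]) auto
  then show ?thesis
    by (simp add: closed_neighbors_def add.commute)
qed

lemma card_nonneighbors:
  assumes "v \<in> V"
  shows "card (nonneighbors v) + degree v + 1 = card V"
  using sum_closed_neighbors_add_nonneighbors[OF assms, of "\<lambda>_. 1 :: nat"]
  by (simp add: degree_def)

lemma degree_sum_split:
  assumes "v \<in> V"
  shows "degree_sum = degree v + neighbor_degree_sum v + (\<Sum>w\<in>nonneighbors v. degree w)"
  using sum_closed_neighbors_add_nonneighbors[OF assms, of degree]
  by (simp add: degree_sum_def neighbor_degree_sum_def)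

lemma sum_neighbors_swap:
  fixes g :: "'a \<Rightarrow> 'a \<Rightarrow> 'b::comm_monoid_add"
  assumes "finite A"
  shows "(\<Sum>w\<in>A. \<Sum>x\<in>N w \<inter> A. g w x) = (\<Sum>w\<in>A. \<Sum>x\<in>N w \<inter> A. g x w)"
proof -
  have restrict: "N w \<inter> A = {x. x \<in> A \<and> x \<in> N w}" for w
    by blast
  have "(\<Sum>w\<in>A. \<Sum>x\<in>{x. x \<in> A \<and> x \<in> N w}. g w x)
      = (\<Sum>x\<in>A. \<Sum>w\<in>{w. w \<in> A \<and> x \<in> N w}. g w x)"
    using assms by (intro sum.swap_restrict)
  then show ?thesis
    by (simp add: restrict neighbors_commute)
qed

lemma sum_neighbor_degree_sum: "(\<Sum>v\<in>V. neighbor_degree_sum v) = degree_square_sum"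
proof -
  have restrict: "N v \<inter> V = N v" for v
    using neighbors_subset by blast
  show ?thesis
    using sum_neighbors_swap[of V "\<lambda>_. degree"]
    by (simp add: neighbor_degree_sum_def degree_square_sum_def restrict degree_def power2_eq_square)
qed

lemma sum_codeg_eq_sum_card_Int:
  assumes "finite A"
  shows "(\<Sum>w\<in>A. codeg V E v w) = (\<Sum>y\<in>N v. card (N y \<inter> A))"
proof -
  have "(\<Sum>w\<in>A. codeg V E v w) = (\<Sum>w\<in>A. \<Sum>y\<in>{y. y \<in> N v \<and> y \<in> N w}. 1)"
    by (simp add: codeg_def Int_def)
  also have "\<dots> = (\<Sum>y\<in>N v. \<Sum>w\<in>{w. w \<in> A \<and> y \<in> N w}. 1)"
    using assms by (intro sum.swap_restrict) simp_all
  also have "\<dots> = (\<Sum>y\<in>N v. card (N y \<inter> A))"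
    by (simp add: neighbors_commute Int_def conj_commute)
  finally show ?thesis .
qed

lemma card_neighbors_nonneighbors:
  assumes "w \<in> nonneighbors v"
  shows "card (N w \<inter> nonneighbors v) + codeg V E v w = degree w"
proof -
  have "N w = (N w \<inter> nonneighbors v) \<union> (N v \<inter> N w)"
    using assms neighbors_subset[of w] neighbors_commute[of v w] by (auto simp: mem_nonneighbors)
  moreover have "(N w \<inter> nonneighbors v) \<inter> (N v \<inter> N w) = {}"
    by (auto simp: mem_nonneighbors)
  ultimately show ?thesis
    unfolding degree_def codeg_def by (metis card_Un_disjoint finite_Int finite_neighbors)
qed

lemma card_neighbors_Un: "card (N v \<union> N w) + codeg V E v w = degree v + degree w"
  using card_Un_Int[of "N v" "N w"] by (simp add: codeg_def degree_def)

end

locale triangle_free_graph = simple_graph +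
  assumes triangle_free: "triangle_free V E"
begin

lemma adjacent_imp_no_common_neighbor:
  assumes "x \<in> N y"
  shows "N x \<inter> N y = {}"
proof (rule ccontr)
  assume "N x \<inter> N y \<noteq> {}"
  then obtain z where "z \<in> N x" "z \<in> N y"
    by blast
  then have "{x, y} \<in> E" "{z, x} \<in> E" "{z, y} \<in> E"
    using assms by (simp_all add: mem_neighbors)
  then have "card {x, y, z} = 3" "clique {x, y, z} E" "{x, y, z} \<subseteq> V"
    using edge_imp_vertices by (auto simp: clique_def card_insert_if insert_commute)
  then show False
    using triangle_free by (auto simp: triangle_free_def)
qed

lemma sum_codeg_nonneighbors:
  assumes "v \<in> V"
  shows "(\<Sum>w\<in>nonneighbors v. codeg V E v w) + degree v = neighbor_degree_sum v"
proof -
  have "card (N y \<inter> nonneighbors v) + 1 = degree y" if "y \<in> N v" for y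
  proof -
    have "N y \<inter> nonneighbors v = N y - {v}"
      using adjacent_imp_no_common_neighbor[OF that] neighbors_subset[of y]
      by (auto simp: mem_nonneighbors)
    moreover have "v \<in> N y"
      using that neighbors_commute by blast
    ultimately show ?thesis
      using card_Suc_Diff1[of "N y" v] by (simp add: degree_def)
  qed
  then have "(\<Sum>y\<in>N v. card (N y \<inter> nonneighbors v) + 1) = neighbor_degree_sum v"
    unfolding neighbor_degree_sum_def by (intro sum.cong) auto
  then show ?thesis
    unfolding sum.distrib by (simp add: sum_codeg_eq_sum_card_Int degree_def)
qed

lemma codeg_add_codeg_le_degree:
  assumes "w \<in> N x"
  shows "codeg V E v w + codeg V E v x \<le> degree v"
proof -
  have "(N v \<inter> N w) \<inter> (N v \<inter> N x) = {}"
    using adjacent_imp_no_common_neighbor[OF assms] by blast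
  then have "codeg V E v w + codeg V E v x = card ((N v \<inter> N w) \<union> (N v \<inter> N x))"
    by (simp add: codeg_def card_Un_disjoint)
  also have "\<dots> \<le> degree v"
    unfolding degree_def by (intro card_mono) auto
  finally show ?thesis .
qed

lemma sum_codeg_over_edges_le:
  assumes "finite A"
  shows "2 * (\<Sum>w\<in>A. codeg V E v w * card (N w \<inter> A)) \<le> degree v * (\<Sum>w\<in>A. card (N w \<inter> A))"
proof -
  have "(\<Sum>w\<in>A. codeg V E v w * card (N w \<inter> A)) = (\<Sum>w\<in>A. \<Sum>x\<in>N w \<inter> A. codeg V E v w)"
    by (simp add: mult.commute)
  then have "2 * (\<Sum>w\<in>A. codeg V E v w * card (N w \<inter> A))
      = (\<Sum>w\<in>A. \<Sum>x\<in>N w \<inter> A. codeg V E v w + codeg V E v x)"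
    using sum_neighbors_swap[OF assms, of "\<lambda>w _. codeg V E v w"] by (simp add: sum.distrib)
  also have "\<dots> \<le> (\<Sum>w\<in>A. \<Sum>x\<in>N w \<inter> A. degree v)"
    using codeg_add_codeg_le_degree neighbors_commute by (intro sum_mono) blast
  also have "\<dots> = degree v * (\<Sum>w\<in>A. card (N w \<inter> A))"
    by (simp add: sum_distrib_left mult.commute)
  finally show ?thesis .
qed

text \<open>If \<open>w\<close> is a non-neighbor of \<open>v\<close>, then the neighbors in \<open>N(v)\<close> of any neighbor of \<open>w\<close> outside
  \<open>N(v)\<close> are exactly the half of \<open>N(v)\<close> missed by \<open>w\<close>. Two such neighbors of \<open>w\<close> thus have all of
  that half, as well as \<open>w\<close>, in common.\<close>

lemma codeg_eq_half_degree_imp_degree_le_2: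
  assumes regular: "\<And>v. v \<in> V \<Longrightarrow> degree v = d"
    and half: "\<And>v w. v \<in> V \<Longrightarrow> w \<in> nonneighbors v \<Longrightarrow> 2 * codeg V E v w = d"
    and v: "v \<in> V" and w: "w \<in> nonneighbors v"
  shows "d \<le> 2"
proof (rule ccontr)
  let ?A = "N w \<inter> nonneighbors v"
  assume "\<not> d \<le> 2"
  moreover have "2 * card ?A = d"
    using card_neighbors_nonneighbors[OF w] half[OF v w] regular[of w] w
    by (simp add: mem_nonneighbors)
  ultimately have "2 \<le> card ?A"
    by linarith
  then obtain x y where x: "x \<in> ?A" and y: "y \<in> ?A" and "x \<noteq> y"
    by (rule obtain_two_elements)
  have other_half: "N v \<inter> N u = N v - N w" if u: "u \<in> ?A" for u
  proof (rule card_subset_eq)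
    show "N v \<inter> N u \<subseteq> N v - N w"
      using u adjacent_imp_no_common_neighbor[of u w] by blast
    have "card (N v - N w) + codeg V E v w = degree v"
      unfolding codeg_def degree_def
      using card_Int_Diff[of "N v" "N w"] by simp
    then show "card (N v \<inter> N u) = card (N v - N w)"
      using half[OF v w] half[OF v, of u] u regular[OF v] by (simp add: codeg_def)
  qed simp
  have "w \<notin> N v" "w \<in> N x \<inter> N y"
    using w x y neighbors_commute by (auto simp: mem_nonneighbors)
  then have "insert w (N v \<inter> N x) \<subseteq> N x \<inter> N y"
    using other_half[OF x] other_half[OF y] by blast
  then have "card (insert w (N v \<inter> N x)) \<le> codeg V E x y"
    unfolding codeg_def by (intro card_mono) auto
  then have "codeg V E v x < codeg V E x y"
    using \<open>w \<notin> N v\<close> by (simp add: codeg_def)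
  moreover have "x \<in> V" "y \<in> nonneighbors x"
    using x y \<open>x \<noteq> y\<close> adjacent_imp_no_common_neighbor[of y x] neighbors_commute
    by (auto simp: mem_nonneighbors)
  ultimately show False
    using half[of x y] half[OF v, of x] x by simp
qed

end

subsection \<open>Graphs in which non-adjacent vertices see a majority\<close>

text \<open>The only such graph is the 5-cycle.\<close>

locale majority_triangle_free_graph = triangle_free_graph +
  assumes card_ge_5: "5 \<le> card V"
    and nonadjacent_majority:
      "v \<in> V \<Longrightarrow> w \<in> nonneighbors v \<Longrightarrow> card V < 2 * card (N v \<union> N w)"
begin

lemma two_codeg_le:
  assumes "v \<in> V" "w \<in> nonneighbors v"
  shows "2 * codeg V E v w + card V + 1 \<le> 2 * degree v + 2 * degree w"
  using nonadjacent_majority[OF assms] card_neighbors_Un[of v w] by linarith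

lemma neighbor_degree_sum_le_averaging:
  assumes v: "v \<in> V"
  shows "4 * neighbor_degree_sum v + 2 * (degree v)\<^sup>2 + (card V)\<^sup>2 + degree v
    \<le> 2 * degree_sum + 3 * card V * degree v + 1"
proof -
  let ?W = "nonneighbors v"
  define codeg_sum outer_degree_sum
    where "codeg_sum = (\<Sum>w\<in>?W. codeg V E v w)" and "outer_degree_sum = (\<Sum>w\<in>?W. degree w)"
  have "(\<Sum>w\<in>?W. 2 * codeg V E v w + (card V + 1)) \<le> (\<Sum>w\<in>?W. 2 * degree v + 2 * degree w)"
    using two_codeg_le[OF v] by (intro sum_mono) simp
  then have "2 * codeg_sum + card ?W * (card V + 1) \<le> card ?W * (2 * degree v) + 2 * outer_degree_sum"
    by (simp only: sum.distrib sum_constant of_nat_id sum_distrib_left[symmetric]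
        distrib_left mult_1_right codeg_sum_def outer_degree_sum_def)
  moreover have "degree_sum = degree v + neighbor_degree_sum v + outer_degree_sum"
    using degree_sum_split[OF v] by (simp add: outer_degree_sum_def)
  moreover have "neighbor_degree_sum v = codeg_sum + degree v"
    using sum_codeg_nonneighbors[OF v] by (simp add: codeg_sum_def)
  ultimately show ?thesis
    unfolding card_nonneighbors[OF v, symmetric]
    by (simp add: algebra_simps power2_eq_square)
qed

lemma neighbor_degree_sum_le_edge_counting:
  assumes v: "v \<in> V"
  shows "(card V + 1) * neighbor_degree_sum v + 2 * (degree v)\<^sup>2
    \<le> degree_sum * degree v + (card V + 1) * degree v"
proof -
  let ?W = "nonneighbors v"
  define codeg_sum inner_degree_sum
    where "codeg_sum = (\<Sum>w\<in>?W. codeg V E v w)"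
      and "inner_degree_sum = (\<Sum>w\<in>?W. card (N w \<inter> ?W))"
  have "card V + 1 \<le> 2 * degree v + 2 * card (N w \<inter> ?W)" if "w \<in> ?W" for w
    using two_codeg_le[OF v that] card_neighbors_nonneighbors[OF that] by linarith
  then have "(\<Sum>w\<in>?W. codeg V E v w * (card V + 1))
      \<le> (\<Sum>w\<in>?W. codeg V E v w * (2 * degree v + 2 * card (N w \<inter> ?W)))"
    by (intro sum_mono mult_left_mono) auto
  also have "\<dots> = 2 * degree v * codeg_sum + 2 * (\<Sum>w\<in>?W. codeg V E v w * card (N w \<inter> ?W))"
    by (simp add: codeg_sum_def sum.distrib sum_distrib_left distrib_left mult_ac)
  also have "\<dots> \<le> 2 * degree v * codeg_sum + degree v * inner_degree_sum"
    using sum_codeg_over_edges_le[of ?W v] by (simp add: inner_degree_sum_def)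
  finally have "codeg_sum * (card V + 1) \<le> 2 * degree v * codeg_sum + degree v * inner_degree_sum"
    by (simp only: codeg_sum_def sum_distrib_right)
  moreover have "inner_degree_sum + codeg_sum = (\<Sum>w\<in>?W. degree w)"
    unfolding codeg_sum_def inner_degree_sum_def sum.distrib[symmetric]
    using card_neighbors_nonneighbors by simp
  then have "degree_sum = degree v + neighbor_degree_sum v + (inner_degree_sum + codeg_sum)"
    using degree_sum_split[OF v] by simp
  moreover have "neighbor_degree_sum v = codeg_sum + degree v"
    using sum_codeg_nonneighbors[OF v] by (simp add: codeg_sum_def)
  ultimately show ?thesis
    by (simp add: algebra_simps power2_eq_square)
qed

lemma degree_square_sum_le_averaging:
  "6 * degree_square_sum + card V ^ 3 + degree_sum \<le> 5 * card V * degree_sum + card V"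
proof -
  have "(\<Sum>v\<in>V. 4 * neighbor_degree_sum v + 2 * (degree v)\<^sup>2 + (card V)\<^sup>2 + degree v)
      \<le> (\<Sum>v\<in>V. 2 * degree_sum + 3 * card V * degree v + 1)"
    by (intro sum_mono neighbor_degree_sum_le_averaging)
  then have "4 * degree_square_sum + 2 * degree_square_sum + card V * (card V)\<^sup>2 + degree_sum
      \<le> card V * (2 * degree_sum) + 3 * card V * degree_sum + card V"
    by (simp only: sum.distrib sum_constant of_nat_id mult_1_right sum_distrib_left[symmetric]
        sum_neighbor_degree_sum degree_sum_def[symmetric] degree_square_sum_def[symmetric])
  then show ?thesis
    by (simp add: algebra_simps power2_eq_square power3_eq_cube)
qed

lemma degree_square_sum_le_edge_counting:
  "(card V + 3) * degree_square_sum \<le> degree_sum\<^sup>2 + (card V + 1) * degree_sum"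
proof -
  have "(\<Sum>v\<in>V. (card V + 1) * neighbor_degree_sum v + 2 * (degree v)\<^sup>2)
      \<le> (\<Sum>v\<in>V. degree_sum * degree v + (card V + 1) * degree v)"
    by (intro sum_mono neighbor_degree_sum_le_edge_counting)
  then have "(card V + 1) * degree_square_sum + 2 * degree_square_sum
      \<le> degree_sum * degree_sum + (card V + 1) * degree_sum"
    by (simp only: sum.distrib sum_distrib_left[symmetric] sum_neighbor_degree_sum
        degree_sum_def[symmetric] degree_square_sum_def[symmetric])
  then show ?thesis
    by (simp add: algebra_simps power2_eq_square)
qed

theorem three_degree_eq:
  assumes "v \<in> V"
  shows "3 * degree v = card V + 1"
proof -
  let ?n = "int (card V)" and ?P = "int degree_sum" and ?Q = "int degree_square_sum"
  have sums: "(\<Sum>v\<in>V. int (degree v)) = ?P" "(\<Sum>v\<in>V. (int (degree v))\<^sup>2) = ?Q"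
    by (simp_all add: degree_sum_def degree_square_sum_def)
  have cauchy_schwarz: "?P\<^sup>2 \<le> ?n * ?Q"
    using sum_squared_le_card_mult_sum_squares[of "\<lambda>v. int (degree v)" V] by (simp only: sums)
  have averaging: "6 * ?Q + ?n ^ 3 + ?P \<le> 5 * ?n * ?P + ?n"
    using of_nat_mono[OF degree_square_sum_le_averaging, where 'a = int] by simp
  have edge_counting: "(?n + 3) * ?Q \<le> ?P\<^sup>2 + (?n + 1) * ?P"
    using of_nat_mono[OF degree_square_sum_le_edge_counting, where 'a = int]
    by (simp add: algebra_simps)
  have "5 \<le> ?n"
    using card_ge_5 by simp
  note tight = moment_inequalities_tight[OF cauchy_schwarz averaging edge_counting this]
  have "?n * int (degree v) = ?P"
    using sum_squared_eq_card_mult_sum_squares_imp_const[of V "\<lambda>v. int (degree v)" v]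
      tight(1) assms by (simp only: sums finite_vertices)
  then have "?n * (3 * int (degree v)) = ?n * (?n + 1)"
    using tight(2) by (simp only: mult.left_commute)
  then have "3 * int (degree v) = ?n + 1"
    unfolding mult_cancel_left using \<open>5 \<le> ?n\<close> by linarith
  then show ?thesis
    by linarith
qed

theorem two_codeg_eq_degree:
  assumes v: "v \<in> V" and w: "w \<in> nonneighbors v"
  shows "2 * codeg V E v w = degree v"
proof (rule sum_mono_inv[OF _ _ w])
  have regular: "degree u = degree v" if "u \<in> V" for u
    using three_degree_eq[OF that] three_degree_eq[OF v] by simp
  show "2 * codeg V E v u \<le> degree v" if u: "u \<in> nonneighbors v" for u
    using two_codeg_le[OF v u] three_degree_eq[OF v] regular[of u] u
    by (simp add: mem_nonneighbors)
  have "neighbor_degree_sum v = (\<Sum>y\<in>N v. degree v)"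
    unfolding neighbor_degree_sum_def using regular neighbors_subset by (intro sum.cong) auto
  then have "neighbor_degree_sum v = degree v * degree v"
    by (simp add: degree_def)
  moreover have "card (nonneighbors v) + 2 = 2 * degree v"
    using card_nonneighbors[OF v] three_degree_eq[OF v] by linarith
  then have "card (nonneighbors v) * degree v + 2 * degree v = 2 * degree v * degree v"
    by (simp flip: add_mult_distrib)
  ultimately have "2 * (\<Sum>u\<in>nonneighbors v. codeg V E v u) = card (nonneighbors v) * degree v"
    using sum_codeg_nonneighbors[OF v] by simp
  then show "(\<Sum>u\<in>nonneighbors v. 2 * codeg V E v u) = (\<Sum>u\<in>nonneighbors v. degree v)"
    by (simp add: sum_distrib_left)
qed simp

theorem degree_eq_2:
  assumes v: "v \<in> V"
  shows "degree v = 2"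
proof -
  have regular: "degree u = degree v" if "u \<in> V" for u
    using three_degree_eq[OF that] three_degree_eq[OF v] by simp
  have half: "2 * codeg V E u w = degree v" if "u \<in> V" "w \<in> nonneighbors u" for u w
    using two_codeg_eq_degree[OF that] regular[OF that(1)] by simp
  have "2 \<le> degree v"
    using three_degree_eq[OF v] card_ge_5 by linarith
  then have "card (nonneighbors v) \<noteq> 0"
    using card_nonneighbors[OF v] three_degree_eq[OF v] by linarith
  then obtain w where "w \<in> nonneighbors v"
    by fastforce
  with regular half v have "degree v \<le> 2"
    by (rule codeg_eq_half_degree_imp_degree_le_2)
  with \<open>2 \<le> degree v\<close> show ?thesis
    by simp
qed

end

theorem (in triangle_free_graph) exists_pair_small_closed_neighbors:
  assumes "2 \<le> card V"
  shows "\<exists>v\<in>V. \<exists>w\<in>V. v \<noteq> w \<and> 2 * card (closed_neighbors v \<union> closed_neighbors w) \<le> card V + 4"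
proof (rule ccontr)
  assume "\<not> ?thesis"
  then have large: "card V + 4 < 2 * card (closed_neighbors v \<union> closed_neighbors w)"
    if "v \<in> V" "w \<in> V" "v \<noteq> w" for v w
    using that by (meson not_le)
  obtain v w where vw: "v \<in> V" "w \<in> V" "v \<noteq> w"
    using assms by (rule obtain_two_elements)
  then have "card (closed_neighbors v \<union> closed_neighbors w) \<le> card V"
    using neighbors_subset by (intro card_mono) (auto simp: closed_neighbors_def)
  then have "5 \<le> card V"
    using large[OF vw] by linarith
  moreover have "card V < 2 * card (N v \<union> N w)" if "v \<in> V" "w \<in> nonneighbors v" for v w
  proof -
    have "card (closed_neighbors v \<union> closed_neighbors w) \<le> card (N v \<union> N w) + 2"
      by (simp add: closed_neighbors_def card_insert_if)
    then show ?thesis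
      using large[of v w] that by (auto simp: mem_nonneighbors)
  qed
  ultimately interpret majority_triangle_free_graph V E
    by unfold_locales
  have "N v \<noteq> {}"
    using degree_eq_2[OF vw(1)] by (auto simp: degree_def)
  then obtain y where y: "y \<in> N v"
    by blast
  then have "y \<in> V" "v \<noteq> y" "closed_neighbors v \<union> closed_neighbors y = N v \<union> N y"
    using neighbors_subset neighbors_commute by (auto simp: closed_neighbors_def)
  then have "card V + 4 < 2 * (degree v + degree y)"
    using large[OF vw(1), of y] card_neighbors_Un[of v y] by simp
  then show False
    using degree_eq_2[OF vw(1)] degree_eq_2[OF \<open>y \<in> V\<close>] card_ge_5 by simp
qed

subsection \<open>Maximum matchings and clique covers\<close>

lemma anti_codeg_le_max_anti_codeg:
  assumes "finite V" "v \<in> V" "w \<in> V" "v \<noteq> w"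
  shows "anti_codeg V E v w \<le> max_anti_codeg V E"
proof -
  have "{anti_codeg V E v w | v w. v \<in> V \<and> w \<in> V \<and> v \<noteq> w}
      \<subseteq> (\<lambda>(v, w). anti_codeg V E v w) ` (V \<times> V)"
    by auto
  then have "finite {anti_codeg V E v w | v w. v \<in> V \<and> w \<in> V \<and> v \<noteq> w}"
    by (rule finite_subset) (simp add: assms(1))
  then show ?thesis
    unfolding max_anti_codeg_def using assms(2-4) by (intro Max_ge) auto
qed

lemma clique_cover_number_le:
  assumes "finite C" "clique_cover V E C"
  shows "clique_cover_number V E \<le> card C"
  unfolding clique_cover_number_def using assms by (intro Least_le) blast

lemma obtain_minimum_clique_cover:
  assumes "finite V"
  obtains C where "finite C" "clique_cover V E C" "card C = clique_cover_number V E"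
proof -
  have "finite ((\<lambda>v. {v}) ` V)" "clique_cover V E ((\<lambda>v. {v}) ` V)"
    using assms by (auto simp: clique_cover_def clique_def)
  then have "\<exists>k C. finite C \<and> card C = k \<and> clique_cover V E C"
    by blast
  then have "\<exists>C. finite C \<and> card C = clique_cover_number V E \<and> clique_cover V E C"
    unfolding clique_cover_number_def by (rule LeastI_ex)
  then show ?thesis
    using that by blast
qed

context simple_graph
begin

definition matching :: "'a set set \<Rightarrow> bool" where
  "matching M \<longleftrightarrow> M \<subseteq> E \<and> disjoint M"

definition maximum_matching :: "'a set set \<Rightarrow> bool" where
  "maximum_matching M \<longleftrightarrow> matching M \<and> (\<forall>M'. matching M' \<longrightarrow> card M' \<le> card M)"

definition unmatched :: "'a set set \<Rightarrow> 'a set" where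
  "unmatched M = V - \<Union>M"

lemma obtain_edge_ends:
  assumes "e \<in> E"
  obtains x y where "e = {x, y}" "x \<in> V" "y \<in> V" "x \<noteq> y"
  using assms edges_subset_nsets by (blast elim: nsets2_E)

lemma finite_matching: "matching M \<Longrightarrow> finite M"
  using finite_edges by (auto simp: matching_def intro: finite_subset)

lemma exists_maximum_matching: "\<exists>M. maximum_matching M"
  unfolding maximum_matching_def
  using ex_has_greatest_nat[of matching "{}" card "Suc (card E)"] card_mono[OF finite_edges]
  by (auto simp: matching_def less_Suc_eq_le)

lemma card_unmatched:
  assumes M: "matching M"
  shows "card V = 2 * card M + card (unmatched M)"
proof -
  have edges: "finite e \<and> card e = 2 \<and> e \<subseteq> V" if "e \<in> M" for e
    using M that edges_subset_nsets by (auto simp: matching_def nsets_def)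
  then have "card (\<Union>M) = (\<Sum>e\<in>M. card e)"
    using M by (intro card_Union_disjoint) (auto simp: matching_def)
  also have "\<dots> = 2 * card M"
    using edges by simp
  finally have "card (\<Union>M) = 2 * card M" .
  moreover have "\<Union>M \<subseteq> V"
    using edges by blast
  ultimately show ?thesis
    unfolding unmatched_def
    by (metis card_Diff_subset card_mono finite_subset finite_vertices le_add_diff_inverse)
qed

lemma clique_cover_number_add_card_matching_le:
  assumes M: "matching M"
  shows "clique_cover_number V E + card M \<le> card V"
proof -
  let ?C = "M \<union> (\<lambda>u. {u}) ` unmatched M"
  have "clique K E \<and> K \<subseteq> V" if "K \<in> M" for K
  proof -
    have "K \<in> E"
      using M that by (auto simp: matching_def)
    moreover from this obtain x y where "K = {x, y}" "x \<in> V" "y \<in> V"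
      by (rule obtain_edge_ends)
    ultimately show ?thesis
      by (auto simp: clique_def insert_commute)
  qed
  then have "clique_cover V E ?C"
    by (auto simp: clique_cover_def clique_def unmatched_def)
  moreover have "finite ?C"
    using finite_matching[OF M] by (simp add: unmatched_def)
  ultimately have "clique_cover_number V E \<le> card ?C"
    by (intro clique_cover_number_le)
  also have "\<dots> \<le> card M + card ((\<lambda>u. {u}) ` unmatched M)"
    by (rule card_Un_le)
  also have "\<dots> = card M + card (unmatched M)"
    by (simp add: card_image)
  finally show ?thesis
    using card_unmatched[OF M] by linarith
qed

lemma matching_insert:
  assumes "matching M" "e \<in> E" "e \<inter> \<Union>M = {}"
  shows "matching (insert e M)" "card (insert e M) = Suc (card M)"
proof -
  show "matching (insert e M)"
    using assms by (auto simp: matching_def pairwise_insert disjnt_def)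
  have "e \<noteq> {}"
    using assms(2) by (auto elim: obtain_edge_ends)
  then have "e \<notin> M"
    using assms(3) by blast
  then show "card (insert e M) = Suc (card M)"
    using finite_matching[OF assms(1)] by simp
qed

lemma matching_remove:
  assumes "matching M" "e \<in> M"
  shows "matching (M - {e})" "\<Union>(M - {e}) = \<Union>M - e"
  using assms by (auto simp: matching_def disjoint_def intro: pairwise_subset)

lemma neighbors_unmatched_subset:
  assumes M: "maximum_matching M" and u: "u \<in> unmatched M"
  shows "N u \<subseteq> \<Union>M"
proof (rule subsetI, rule ccontr)
  fix x assume x: "x \<in> N u" "x \<notin> \<Union>M"
  then have "{x, u} \<in> E" "{x, u} \<inter> \<Union>M = {}"
    using u by (auto simp: mem_neighbors unmatched_def)
  then show False
    using M matching_insert[of M "{x, u}"] unfolding maximum_matching_def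
    by (metis Suc_n_not_le_n)
qed

lemma maximum_matching_no_augmenting_path:
  assumes M: "maximum_matching M" and xy: "{x, y} \<in> M"
    and s: "s \<in> unmatched M" and t: "t \<in> unmatched M" and "s \<noteq> t" and x: "x \<in> N s"
  shows "y \<notin> N t"
proof
  assume "y \<in> N t"
  let ?M = "M - {{x, y}}"
  have matching: "matching M"
    using M by (simp add: maximum_matching_def)
  note removed = matching_remove[OF matching xy]
  have "{x, y} \<in> E"
    using matching xy by (auto simp: matching_def)
  then have distinct: "x \<noteq> y" "s \<notin> {x, y}" "t \<notin> {x, y}"
    using edge_imp_vertices(3) xy s t by (auto simp: unmatched_def)
  have "{x, s} \<in> E" "{x, s} \<inter> \<Union>?M = {}"
    using x s unfolding removed(2) by (auto simp: mem_neighbors unmatched_def)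
  note inserted = matching_insert[OF removed(1) this]
  have "{y, t} \<in> E" "{y, t} \<inter> \<Union>(insert {x, s} ?M) = {}"
    using \<open>y \<in> N t\<close> t \<open>s \<noteq> t\<close> distinct unfolding Union_insert removed(2)
    by (auto simp: mem_neighbors unmatched_def)
  note augmented = matching_insert[OF inserted(1) this]
  have "Suc (card ?M) = card M"
    using finite_matching[OF matching] xy by (intro card_Suc_Diff1)
  then show False
    using M augmented inserted(2) unfolding maximum_matching_def
    by (metis Suc_n_not_le_n)
qed

lemma card_le_closed_neighbors_add_max_anti_codeg:
  assumes "v \<in> V" "w \<in> V" "v \<noteq> w"
  shows "card V \<le> card (closed_neighbors v \<union> closed_neighbors w) + max_anti_codeg V E"
proof -
  have "closed_neighbors v \<union> closed_neighbors w = N v \<union> N w \<union> {v, w}"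
    by (auto simp: closed_neighbors_def)
  then have "card V - card (closed_neighbors v \<union> closed_neighbors w) \<le> anti_codeg V E v w"
    by (simp add: anti_codeg_def diff_card_le_card_Diff)
  also have "\<dots> \<le> max_anti_codeg V E"
    using finite_vertices assms by (rule anti_codeg_le_max_anti_codeg)
  finally show ?thesis
    by linarith
qed

end

context triangle_free_graph
begin

lemma card_edge_Int_neighbors_unmatched_le:
  assumes M: "maximum_matching M" and e: "e \<in> M"
    and u: "u \<in> unmatched M" "u' \<in> unmatched M" "u \<noteq> u'"
  shows "card (e \<inter> (N u \<union> N u')) \<le> 1"
proof (rule ccontr)
  assume "\<not> ?thesis"
  then have "2 \<le> card (e \<inter> (N u \<union> N u'))"
    by simp
  then obtain x y where xy: "x \<in> e" "y \<in> e" "x \<noteq> y" "x \<in> N u \<union> N u'" "y \<in> N u \<union> N u'"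
    by (rule obtain_two_elements) blast
  have "e \<in> E"
    using M e by (auto simp: maximum_matching_def matching_def)
  then have "e = {x, y}"
    using xy by (auto elim: obtain_edge_ends)
  then have "y \<in> N x"
    using \<open>e \<in> E\<close> by (simp add: mem_neighbors insert_commute)
  then have "N y \<inter> N x = {}"
    by (rule adjacent_imp_no_common_neighbor)
  then have "x \<in> N u \<and> y \<in> N u' \<or> x \<in> N u' \<and> y \<in> N u"
    using xy neighbors_commute by blast
  then show False
    using maximum_matching_no_augmenting_path[OF M] e \<open>e = {x, y}\<close> u by metis
qed

lemma card_closed_neighbors_unmatched_le:
  assumes M: "maximum_matching M" and u: "u \<in> unmatched M" "u' \<in> unmatched M" "u \<noteq> u'"
  shows "card (closed_neighbors u \<union> closed_neighbors u') \<le> card M + 2"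
proof -
  have "finite M"
    using M finite_matching by (simp add: maximum_matching_def)
  moreover have "N u \<union> N u' \<subseteq> \<Union>M"
    using neighbors_unmatched_subset[OF M] u by blast
  ultimately have "card (N u \<union> N u') \<le> card M"
    using card_edge_Int_neighbors_unmatched_le[OF M _ u]
    by (rule card_le_if_each_meets_at_most_once)
  then show ?thesis
    using u(3) by (simp add: closed_neighbors_def card_insert_if)
qed

theorem clique_cover_number_le_max_anti_codeg: "clique_cover_number V E \<le> max_anti_codeg V E + 2"
proof -
  obtain M where max: "maximum_matching M"
    using exists_maximum_matching by blast
  then have M: "matching M"
    by (simp add: maximum_matching_def)
  note cover = clique_cover_number_add_card_matching_le[OF M]
  consider "card V \<le> 1" | "2 \<le> card V" "card (unmatched M) \<le> 1" | "2 \<le> card (unmatched M)"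
    by linarith
  then show ?thesis
  proof cases
    case 1
    then show ?thesis
      using cover by linarith
  next
    case 2
    then obtain v w where "v \<in> V" "w \<in> V" "v \<noteq> w"
      and "2 * card (closed_neighbors v \<union> closed_neighbors w) \<le> card V + 4"
      using exists_pair_small_closed_neighbors by blast
    then show ?thesis
      using card_le_closed_neighbors_add_max_anti_codeg[of v w] card_unmatched[OF M] cover 2
      by linarith
  next
    case 3
    then obtain u u' where u: "u \<in> unmatched M" "u' \<in> unmatched M" "u \<noteq> u'"
      by (rule obtain_two_elements)
    then show ?thesis
      using card_le_closed_neighbors_add_max_anti_codeg[of u u']
        card_closed_neighbors_unmatched_le[OF max u] cover
      by (simp add: unmatched_def)
  qed
qed

end

subsection \<open>Complements\<close>

lemma clique_complement_iff_indep:
  assumes "S \<subseteq> V"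
  shows "clique S ([V]\<^bsup>2\<^esup> - E) \<longleftrightarrow> indep S E"
  using assms by (auto simp: clique_def indep_def)

lemma card_indep_le_independence_number:
  assumes "finite V" "S \<subseteq> V" "indep S E"
  shows "card S \<le> independence_number V E"
proof -
  have "{card S | S. S \<subseteq> V \<and> indep S E} \<subseteq> card ` Pow V"
    by auto
  then have "finite {card S | S. S \<subseteq> V \<and> indep S E}"
    by (rule finite_subset) (simp add: assms(1))
  then show ?thesis
    unfolding independence_number_def using assms by (intro Max_ge) auto
qed

lemma triangle_free_complement:
  assumes "finite V" "independence_number V E \<le> 2"
  shows "triangle_free V ([V]\<^bsup>2\<^esup> - E)"
proof -
  have "card T \<noteq> 3" if "T \<subseteq> V" "clique T ([V]\<^bsup>2\<^esup> - E)" for T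
  proof -
    have "indep T E"
      using that by (simp add: clique_complement_iff_indep)
    then have "card T \<le> independence_number V E"
      by (rule card_indep_le_independence_number[OF assms(1) that(1)])
    then show ?thesis
      using assms(2) by linarith
  qed
  then show ?thesis
    by (auto simp: triangle_free_def)
qed

lemma (in simple_graph) chromatic_number_le_clique_cover_number_complement:
  "chromatic_number V E \<le> clique_cover_number V ([V]\<^bsup>2\<^esup> - E)"
proof -
  obtain C where C: "finite C" "clique_cover V ([V]\<^bsup>2\<^esup> - E) C"
    and card_C: "card C = clique_cover_number V ([V]\<^bsup>2\<^esup> - E)"
    using obtain_minimum_clique_cover[OF finite_vertices] .
  obtain g where g: "bij_betw g C {..<card C}"
    using ex_bij_betw_finite_nat[OF C(1)] by (auto simp: atLeast0LessThan)
  have "\<forall>v\<in>V. \<exists>K. K \<in> C \<and> v \<in> K"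
    using C(2) by (auto simp: clique_cover_def)
  then obtain K where K: "\<And>v. v \<in> V \<Longrightarrow> K v \<in> C \<and> v \<in> K v"
    by metis
  have "(g \<circ> K) ` V \<subseteq> {..<card C}"
    using K g by (auto simp: bij_betw_def)
  moreover have "proper_coloring V E (g \<circ> K)"
    unfolding proper_coloring_def
  proof (intro ballI impI notI)
    fix u v assume uv: "u \<in> V" "v \<in> V" "{u, v} \<in> E" and "(g \<circ> K) u = (g \<circ> K) v"
    then have "K u = K v"
      using g K by (auto simp: bij_betw_def dest: inj_onD)
    moreover have "indep (K u) E"
      using C(2) K[OF uv(1)] clique_complement_iff_indep[of "K u" V E]
      by (simp add: clique_cover_def)
    ultimately show False
      using K[OF uv(1)] K[OF uv(2)] uv(3) edge_imp_vertices(3)[OF uv(3)]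
      by (simp add: indep_def)
  qed
  ultimately show ?thesis
    unfolding chromatic_number_def card_C[symmetric] by (intro Least_le) blast
qed

theorem theorem5p3:
  shows "(\<forall>(V :: 'a set) E. finite_simple_graph V E \<and> independence_number V E \<le> 2 \<longrightarrow>
            chromatic_number V E \<le> max_codeg V E + 2) \<and>
         (\<forall>(V :: 'a set) E. finite_simple_graph V E \<and> triangle_free V E \<longrightarrow>
            clique_cover_number V E \<le> max_anti_codeg V E + 2)"
proof (intro conjI allI impI; elim conjE)
  fix V :: "'a set" and E
  assume simple: "finite_simple_graph V E" and "independence_number V E \<le> 2"
  let ?E = "[V]\<^bsup>2\<^esup> - E"
  interpret simple_graph V E
    using simple by unfold_locales
  interpret complement: triangle_free_graph V ?E
    using triangle_free_complement[OF finite_vertices \<open>independence_number V E \<le> 2\<close>]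
    by unfold_locales (simp_all add: finite_simple_graph_def)
  have "max_anti_codeg V ?E = max_codeg V E"
    using edges_subset_nsets
    by (simp add: max_anti_codeg_eq_max_codeg_complement double_diff)
  then show "chromatic_number V E \<le> max_codeg V E + 2"
    using chromatic_number_le_clique_cover_number_complement
      complement.clique_cover_number_le_max_anti_codeg by simp
next
  fix V :: "'a set" and E
  assume "finite_simple_graph V E" "triangle_free V E"
  then interpret triangle_free_graph V E
    by unfold_locales
  show "clique_cover_number V E \<le> max_anti_codeg V E + 2"
    by (rule clique_cover_number_le_max_anti_codeg)
qed

end
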